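(* Let $f$ be smooth, $r_0>0$, $J$ an open interval, $a:J\to(0,\infty)$ smooth with $1-r_0\dot a\neq0$, and suppose the spatially flat FLRW spacetime with scale factor $a$ is matched, by the conditions (M1)--(M6) below, to a generalized Vaidya exterior whose Ricci scalar satisfies $f_{,R}(R_+(v,r_v))=A(v)r_v+B(v)$ with $A,B$ smooth. Assume $f_{,RR}(R_-(t))\neq0$ for $t\in J$ and that $A(\mathcal{T}(t))=0$ for all $t\in J$. Then the interior Ricci scalar is constant on $J$, $R_-(t)=R_0$. Suppose moreover that the interior satisfies the metric $f(R)$ field equations with a perfect-fluid energy-momentum tensor $T^-_{\mu\nu}$ of energy density $\rho(t)$ and pressure $p(t)$ obeying $\dot\rho+3H(\rho+p)=0$, $H=\dot a/a$. Then: (i) the interior field equations reduce to $$f_{,R}(R_0)\,G^-_{\mu\nu}+\tfrac12\bigl(f_{,R}(R_0)R_0-f(R_0)\bigr)g^-_{\mu\nu}=\kappa\,T^-_{\mu\nu};$$ (ii) the trace $T^-=-\rho+3p$ equals a constant $T_0$, with $\kappa T_0=f_{,R}(R_0)R_0-2f(R_0)$, so $p=\frac{\rho+T_0}{3}$; (iii) there is a constant $C$ with $$\rho=\frac{C}{a^4}-\frac{T_0}{4},\qquad p=\frac{C}{3a^4}+\frac{T_0}{4};$$ (iv) if the interior matter is dust ($p=0$, $\rho>0$), then $\rho$ is constant and $\dot a=0$ on $J$ (the configuration is static), so dust collapse is excluded.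
   Context: The interior metric is $ds_-^2=-dt^2+a^2(t)(dr^2+r^2d\Omega^2)$, with Ricci scalar $R_-(t)=6\left(\frac{\ddot a}{a}+\frac{\dot a^2}{a^2}\right)$ and Einstein tensor $G^-_{\mu\nu}$. The exterior metric is $ds_+^2=-\left(1-\frac{2M(v,r_v)}{r_v}\right)dv^2+2\,dv\,dr_v+r_v^2d\Omega^2$, with $M$ smooth and Ricci scalar $R_+=\frac{2}{r_v^2}\left(r_vM_{,r_vr_v}+2M_{,r_v}\right)$. The metric $f(R)$ field equations are $f_{,R}R_{\mu\nu}-\frac12 f(R)g_{\mu\nu}+(g_{\mu\nu}\Box-\nabla_\mu\nabla_\nu)f_{,R}=\kappa T_{\mu\nu}$, with trace $3\Box f_{,R}+f_{,R}R-2f(R)=\kappa T$, where $f_{,R}=df/dR$, $f_{,RR}=d^2f/dR^2$ and $\kappa=8\pi G>0$. The matching hypersurface is $r=r_0$ from the interior and $v=\mathcal{T}(t)$, $r_v=\mathcal{R}(t)$ from the exterior. The matching conditions, for all $t\in J$, are: (M1) $\mathcal{R}(t)=r_0a(t)$; (M2) $\dot{\mathcal{T}}(t)=\frac{1}{1-r_0\dot a(t)}$; (M3) $M(\mathcal{T}(t),\mathcal{R}(t))=\frac{r_0^3}{2}a\dot a^2$; (M4) $M_{,r_v}(\mathcal{T}(t),\mathcal{R}(t))=r_0^2\left(\frac12\dot a^2+a\ddot a\right)$; (M5) $R_+(\mathcal{T}(t),\mathcal{R}(t))=R_-(t)$; (M6) $\left[\partial_vR_++(1-\dot{\mathcal{R}}(t))\,\partial_{r_v}R_+\right](\mathcal{T}(t),\mathcal{R}(t))=0$.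 *)

theory Defs
  imports "HOL-Analysis.Analysis"
begin

section \<open>Smooth functions on open sets\<close>

text \<open>To be used on open sets only: the derivatives are unrestricted ones.\<close>

primrec Ck_on :: "nat \<Rightarrow> 'a::euclidean_space set \<Rightarrow> ('a \<Rightarrow> real) \<Rightarrow> bool" where
  "Ck_on 0 S f \<longleftrightarrow> continuous_on S f"
| "Ck_on (Suc k) S f \<longleftrightarrow> (\<forall>x\<in>S. f differentiable (at x)) \<and>
     (\<forall>b\<in>Basis. Ck_on k S (\<lambda>x. frechet_derivative f (at x) b))"

definition smooth_on :: "'a::euclidean_space set \<Rightarrow> ('a \<Rightarrow> real) \<Rightarrow> bool" where
  "smooth_on S f \<longleftrightarrow> (\<forall>k. Ck_on k S f)"


section \<open>Curvature of a metric given in a coordinate chart\<close>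

type_synonym point = "real ^ 4"
type_synonym tensor2 = "real ^ 4 ^ 4"

definition partial :: "4 \<Rightarrow> (point \<Rightarrow> real) \<Rightarrow> point \<Rightarrow> real" where
  "partial i F x = deriv (\<lambda>s. F (\<chi> j. if j = i then s else x $ j)) (x $ i)"

text \<open>Christoffel symbols $\Gamma^k_{ij}$, Riemann tensor $R^k{}_{lij}$ and Ricci tensor
  $R_{ij} = R^k{}_{ikj}$; all indices are written in this order.\<close>

definition christoffel :: "(point \<Rightarrow> tensor2) \<Rightarrow> point \<Rightarrow> 4 \<Rightarrow> 4 \<Rightarrow> 4 \<Rightarrow> real" where
  "christoffel g x k i j =
     (1/2) * (\<Sum>l\<in>UNIV. matrix_inv (g x) $ k $ l *
        (partial i (\<lambda>y. g y $ j $ l) x + partial j (\<lambda>y. g y $ i $ l) x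
          - partial l (\<lambda>y. g y $ i $ j) x))"

definition riemann :: "(point \<Rightarrow> tensor2) \<Rightarrow> point \<Rightarrow> 4 \<Rightarrow> 4 \<Rightarrow> 4 \<Rightarrow> 4 \<Rightarrow> real" where
  "riemann g x k l i j =
     partial i (\<lambda>y. christoffel g y k j l) x - partial j (\<lambda>y. christoffel g y k i l) x
     + (\<Sum>m\<in>UNIV. christoffel g x k i m * christoffel g x m j l
                  - christoffel g x k j m * christoffel g x m i l)"

definition ricci :: "(point \<Rightarrow> tensor2) \<Rightarrow> point \<Rightarrow> tensor2" where
  "ricci g x = (\<chi> i j. \<Sum>k\<in>UNIV. riemann g x k i k j)"

text \<open>The contraction $g^{ij} S_{ij}$.\<close>

definition metric_trace :: "(point \<Rightarrow> tensor2) \<Rightarrow> point \<Rightarrow> tensor2 \<Rightarrow> real" where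
  "metric_trace g x S = (\<Sum>i\<in>UNIV. \<Sum>j\<in>UNIV. matrix_inv (g x) $ i $ j * S $ i $ j)"

definition scalar_curvature :: "(point \<Rightarrow> tensor2) \<Rightarrow> point \<Rightarrow> real" where
  "scalar_curvature g x = metric_trace g x (ricci g x)"

definition einstein :: "(point \<Rightarrow> tensor2) \<Rightarrow> point \<Rightarrow> tensor2" where
  "einstein g x = ricci g x - (scalar_curvature g x / 2) *\<^sub>R g x"

text \<open>$\nabla_i \nabla_j \varphi$ and $\Box \varphi$ for a scalar field $\varphi$.\<close>

definition hessian :: "(point \<Rightarrow> tensor2) \<Rightarrow> (point \<Rightarrow> real) \<Rightarrow> point \<Rightarrow> tensor2" where
  "hessian g \<phi> x = (\<chi> i j. partial i (partial j \<phi>) x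
     - (\<Sum>k\<in>UNIV. christoffel g x k i j * partial k \<phi> x))"

definition dalembertian :: "(point \<Rightarrow> tensor2) \<Rightarrow> (point \<Rightarrow> real) \<Rightarrow> point \<Rightarrow> real" where
  "dalembertian g \<phi> x = metric_trace g x (hessian g \<phi> x)"


section \<open>Metric \<open>f(R)\<close> gravity\<close>

text \<open>The left-hand side of the metric \<open>f(R)\<close> field equations.\<close>

definition fR_tensor :: "(real \<Rightarrow> real) \<Rightarrow> (point \<Rightarrow> tensor2) \<Rightarrow> point \<Rightarrow> tensor2" where
  "fR_tensor f g x =
     (let \<phi> = (\<lambda>y. deriv f (scalar_curvature g y)) in
        \<phi> x *\<^sub>R ricci g x - (f (scalar_curvature g x) / 2) *\<^sub>R g x
        + dalembertian g \<phi> x *\<^sub>R g x - hessian g \<phi> x)"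

text \<open>$T_{ij} = (\rho + p) u_i u_j + p g_{ij}$, where \<open>u\<close> has contravariant components.\<close>

definition perfect_fluid ::
    "(point \<Rightarrow> tensor2) \<Rightarrow> real ^ 4 \<Rightarrow> real \<Rightarrow> real \<Rightarrow> point \<Rightarrow> tensor2" where
  "perfect_fluid g u \<rho> p x =
     (let w = g x *v u in (\<chi> i j. (\<rho> + p) * w $ i * w $ j + p * g x $ i $ j))"


section \<open>The interior and exterior spacetimes\<close>

text \<open>Coordinates $(t, r, \theta, \phi)$, numbered 1 to 4.\<close>

definition flrw :: "(real \<Rightarrow> real) \<Rightarrow> point \<Rightarrow> tensor2" where
  "flrw a x = (let t = x $ 1; r = x $ 2; \<theta> = x $ 3 in vector
     [vector [-1, 0, 0, 0],
      vector [0, (a t)\<^sup>2, 0, 0],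
      vector [0, 0, (a t)\<^sup>2 * r\<^sup>2, 0],
      vector [0, 0, 0, (a t)\<^sup>2 * r\<^sup>2 * (sin \<theta>)\<^sup>2]])"

definition flrw_scalar :: "(real \<Rightarrow> real) \<Rightarrow> real \<Rightarrow> real" where
  "flrw_scalar a t = 6 * (deriv (deriv a) t / a t + (deriv a t)\<^sup>2 / (a t)\<^sup>2)"

definition comoving :: "real ^ 4" where
  "comoving = vector [1, 0, 0, 0]"

definition interior_region :: "real set \<Rightarrow> real \<Rightarrow> point set" where
  "interior_region J r0 =
     {x. x $ 1 \<in> J \<and> 0 < x $ 2 \<and> x $ 2 < r0 \<and> 0 < x $ 3 \<and> x $ 3 < pi \<and> 0 < x $ 4 \<and> x $ 4 < 2 * pi}"

text \<open>Coordinates $(v, r_v, \theta, \phi)$, numbered 1 to 4; the cross term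
  $2\,dv\,dr_v$ gives the off-diagonal components 1.\<close>

definition vaidya :: "(real \<Rightarrow> real \<Rightarrow> real) \<Rightarrow> point \<Rightarrow> tensor2" where
  "vaidya M x = (let v = x $ 1; r = x $ 2; \<theta> = x $ 3 in vector
     [vector [- (1 - 2 * M v r / r), 1, 0, 0],
      vector [1, 0, 0, 0],
      vector [0, 0, r\<^sup>2, 0],
      vector [0, 0, 0, r\<^sup>2 * (sin \<theta>)\<^sup>2]])"

definition vaidya_scalar :: "(real \<Rightarrow> real \<Rightarrow> real) \<Rightarrow> real \<Rightarrow> real \<Rightarrow> real" where
  "vaidya_scalar M v r = 2 / r\<^sup>2 * (r * deriv (deriv (M v)) r + 2 * deriv (M v) r)"

text \<open>The side $r_v \ge \mathcal{R}(t)$ of the hypersurface $v = T(t)$, $r_v = \mathcal{R}(t)$ on which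
  the exterior lies. The chart domain \<open>U\<close> is an open neighbourhood of that hypersurface, so that
  derivatives on the hypersurface make sense.\<close>

definition exterior_region ::
    "(real \<times> real) set \<Rightarrow> real set \<Rightarrow> (real \<Rightarrow> real) \<Rightarrow> (real \<Rightarrow> real) \<Rightarrow> point set" where
  "exterior_region U J T Rb =
     {x. (x $ 1, x $ 2) \<in> U \<and> (\<exists>t\<in>J. x $ 1 = T t \<and> Rb t \<le> x $ 2) \<and>
         0 < x $ 3 \<and> x $ 3 < pi \<and> 0 < x $ 4 \<and> x $ 4 < 2 * pi}"


section \<open>The closed formulas are the scalar curvatures of the two metrics\<close>

text \<open>The results are \<open>flrw_scalar_curvature\<close> and \<open>vaidya_scalar_curvature\<close>; everything before
  them computes Christoffel symbols and their derivatives.\<close>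

lemma vector_4 [simp]:
  "(vector [a, b, c, d] :: 'a::zero ^ 4) $ 1 = a"
  "(vector [a, b, c, d] :: 'a::zero ^ 4) $ 2 = b"
  "(vector [a, b, c, d] :: 'a::zero ^ 4) $ 3 = c"
  "(vector [a, b, c, d] :: 'a::zero ^ 4) $ 4 = d"
  by (simp_all add: vector_def)

lemma matrix_inv_eqI:
  fixes A B :: "real ^ 'n ^ 'n"
  assumes "A ** B = mat 1"
  shows "matrix_inv A = B"
proof -
  have BA: "B ** A = mat 1" using assms by (simp add: matrix_left_right_inverse)
  then have "invertible A" using assms by (auto simp: invertible_def)
  then have "matrix_inv A ** A = mat 1" unfolding invertible_def matrix_inv_def by (rule someI2_ex) simp
  then have "matrix_inv A ** (A ** B) = B" by (simp add: matrix_mul_assoc)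
  then show ?thesis using assms by simp
qed

lemma partial_cong:
  assumes "open S" "x \<in> S" "\<And>y. y \<in> S \<Longrightarrow> F y = G y"
  shows "partial i F x = partial i G x"
proof -
  define c where "c = (\<lambda>s. (\<chi> j. if j = i then s else x $ j) :: point)"
  have cx: "c (x $ i) = x" by (simp add: c_def vec_eq_iff)
  have "isCont c (x $ i)" unfolding c_def isCont_def
  proof (rule vec_tendstoI)
    fix j
    show "((\<lambda>s. (\<chi> j. if j = i then s else x $ j) $ j) \<longlongrightarrow> (\<chi> j. if j = i then x $ i else x $ j) $ j) (at (x $ i))"
      by (cases "j = i") auto
  qed
  then have "eventually (\<lambda>s. c s \<in> S) (nhds (x $ i))"
    
    using assms(1,2) cx
    by (auto simp: eventually_nhds_conv_at isCont_def dest: topological_tendstoD)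
  then have "eventually (\<lambda>s. F (c s) = G (c s)) (nhds (x $ i))"
    by (rule eventually_mono) (use assms in auto)
  then show ?thesis unfolding partial_def c_def by (rule deriv_cong_ev) simp
qed

lemma partialI:
  "((\<lambda>s. F (\<chi> j. if j = i then s else x $ j)) has_real_derivative D) (at (x $ i))
    \<Longrightarrow> partial i F x = D"
  unfolding partial_def by (rule DERIV_imp_deriv)

lemma sin_nz: "0 < t \<Longrightarrow> t < pi \<Longrightarrow> sin t \<noteq> 0"
  using sin_gt_zero by fastforce

definition flrw_region :: "real set \<Rightarrow> point set" where
  "flrw_region J = {x. x $ 1 \<in> J \<and> 0 < x $ 2 \<and> 0 < x $ 3 \<and> x $ 3 < pi}"

lemma open_flrw_region: "open J \<Longrightarrow> open (flrw_region J)"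
proof -
  assume J: "open J"
  have "flrw_region J = ((\<lambda>x. x $ 1) -` J) \<inter> {x. 0 < x $ 2} \<inter> {x. 0 < x $ 3} \<inter> {x. x $ 3 < pi}"
    by (auto simp: flrw_region_def)
  then show ?thesis using J
    by (auto intro!: open_Int open_Collect_less continuous_intros open_vimage)
qed

definition flrw_gamma :: "(real \<Rightarrow> real) \<Rightarrow> point \<Rightarrow> 4 \<Rightarrow> 4 \<Rightarrow> 4 \<Rightarrow> real" where
  "flrw_gamma a x k i j =
    (let t = x $ 1; r = x $ 2; \<theta> = x $ 3; H = deriv a t / a t in
     if k = 1 then
       (if i = 2 \<and> j = 2 then a t * deriv a t
        else if i = 3 \<and> j = 3 then a t * deriv a t * r\<^sup>2
        else if i = 4 \<and> j = 4 then a t * deriv a t * r\<^sup>2 * (sin \<theta>)\<^sup>2 else 0)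
     else if k = 2 then
       (if {i, j} = {1, 2} then H
        else if i = 3 \<and> j = 3 then - r
        else if i = 4 \<and> j = 4 then - r * (sin \<theta>)\<^sup>2 else 0)
     else if k = 3 then
       (if {i, j} = {1, 3} then H
        else if {i, j} = {2, 3} then 1 / r
        else if i = 4 \<and> j = 4 then - sin \<theta> * cos \<theta> else 0)
     else
       (if {i, j} = {1, 4} then H
        else if {i, j} = {2, 4} then 1 / r
        else if {i, j} = {3, 4} then cos \<theta> / sin \<theta> else 0))"

lemma flrw_inv:
  assumes "a (x $ 1) \<noteq> 0" "x $ 2 \<noteq> 0" "sin (x $ 3) \<noteq> 0"
  shows "matrix_inv (flrw a x) = (let t = x $ 1; r = x $ 2; \<theta> = x $ 3 in vector
     [vector [-1, 0, 0, 0],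
      vector [0, 1 / (a t)\<^sup>2, 0, 0],
      vector [0, 0, 1 / ((a t)\<^sup>2 * r\<^sup>2), 0],
      vector [0, 0, 0, 1 / ((a t)\<^sup>2 * r\<^sup>2 * (sin \<theta>)\<^sup>2)]])"
  using assms
  by (intro matrix_inv_eqI)
     (simp add: flrw_def Let_def matrix_matrix_mult_def vec_eq_iff forall_4 sum_4 mat_def)

lemma flrw_partial:
  fixes x :: point
  assumes "a differentiable (at (x $ 1))"
  shows "partial l (\<lambda>y. flrw a y $ i $ j) x =
    (let t = x $ 1; r = x $ 2; \<theta> = x $ 3 in
     if i \<noteq> j \<or> i = 1 then 0
     else if l = 1 then 2 * a t * deriv a t * (if i = 2 then 1 else if i = 3 then r\<^sup>2 else r\<^sup>2 * (sin \<theta>)\<^sup>2)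
     else if l = 2 then (a t)\<^sup>2 * (2 * r) * (if i = 2 then 0 else if i = 3 then 1 else (sin \<theta>)\<^sup>2)
     else if l = 3 then (if i = 4 then (a t)\<^sup>2 * r\<^sup>2 * (2 * sin \<theta> * cos \<theta>) else 0)
     else 0)"
proof -
  have d: "(a has_real_derivative deriv a (x $ 1)) (at (x $ 1))"
    using assms by (simp add: DERIV_deriv_iff_real_differentiable)
  have "\<forall>l i j. partial l (\<lambda>y. flrw a y $ i $ j) x =
    (let t = x $ 1; r = x $ 2; \<theta> = x $ 3 in
     if i \<noteq> j \<or> i = 1 then 0
     else if l = 1 then 2 * a t * deriv a t * (if i = 2 then 1 else if i = 3 then r\<^sup>2 else r\<^sup>2 * (sin \<theta>)\<^sup>2)
     else if l = 2 then (a t)\<^sup>2 * (2 * r) * (if i = 2 then 0 else if i = 3 then 1 else (sin \<theta>)\<^sup>2)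
     else if l = 3 then (if i = 4 then (a t)\<^sup>2 * r\<^sup>2 * (2 * sin \<theta> * cos \<theta>) else 0)
     else 0)"
    unfolding forall_4 
    by (intro conjI; rule partialI; simp add: flrw_def Let_def)
       (auto intro!: derivative_eq_intros d)
  then show ?thesis by blast
qed

lemma flrw_christoffel:
  fixes x :: point
  assumes a: "a differentiable (at (x $ 1))"
    and nz: "a (x $ 1) \<noteq> 0" "x $ 2 \<noteq> 0" "sin (x $ 3) \<noteq> 0"
  shows "christoffel (flrw a) x k i j = flrw_gamma a x k i j"
proof -
  have "\<forall>k i j. christoffel (flrw a) x k i j = flrw_gamma a x k i j"
    unfolding forall_4 christoffel_def sum_4 flrw_partial[OF a] flrw_inv[of a x, OF nz] flrw_gamma_def
    using nz by (simp add: Let_def doubleton_eq_iff power2_eq_square)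
  then show ?thesis by blast
qed

definition flrw_dgamma :: "(real \<Rightarrow> real) \<Rightarrow> point \<Rightarrow> 4 \<Rightarrow> 4 \<Rightarrow> 4 \<Rightarrow> 4 \<Rightarrow> real" where
  "flrw_dgamma a x l k i j =
    (let t = x $ 1; r = x $ 2; \<theta> = x $ 3; b = deriv a t; c = deriv (deriv a) t;
         q = b\<^sup>2 + a t * c; H' = c / a t - b\<^sup>2 / (a t)\<^sup>2 in
     if k = 1 then
       (if i = 2 \<and> j = 2 then (if l = 1 then q else 0)
        else if i = 3 \<and> j = 3 then (if l = 1 then q * r\<^sup>2 else if l = 2 then a t * b * (2 * r) else 0)
        else if i = 4 \<and> j = 4 then
          (if l = 1 then q * r\<^sup>2 * (sin \<theta>)\<^sup>2 else if l = 2 then a t * b * (2 * r) * (sin \<theta>)\<^sup>2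
           else if l = 3 then a t * b * r\<^sup>2 * (2 * sin \<theta> * cos \<theta>) else 0) else 0)
     else if k = 2 then
       (if {i, j} = {1, 2} then (if l = 1 then H' else 0)
        else if i = 3 \<and> j = 3 then (if l = 2 then - 1 else 0)
        else if i = 4 \<and> j = 4 then
          (if l = 2 then - (sin \<theta>)\<^sup>2 else if l = 3 then - r * (2 * sin \<theta> * cos \<theta>) else 0) else 0)
     else if k = 3 then
       (if {i, j} = {1, 3} then (if l = 1 then H' else 0)
        else if {i, j} = {2, 3} then (if l = 2 then - 1 / r\<^sup>2 else 0)
        else if i = 4 \<and> j = 4 then (if l = 3 then (sin \<theta>)\<^sup>2 - (cos \<theta>)\<^sup>2 else 0) else 0)
     else
       (if {i, j} = {1, 4} then (if l = 1 then H' else 0)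
        else if {i, j} = {2, 4} then (if l = 2 then - 1 / r\<^sup>2 else 0)
        else if {i, j} = {3, 4} then (if l = 3 then - 1 / (sin \<theta>)\<^sup>2 else 0) else 0))"

lemma flrw_dgamma_eq:
  fixes x :: point
  assumes a: "a differentiable (at (x $ 1))" "deriv a differentiable (at (x $ 1))"
    and nz: "a (x $ 1) \<noteq> 0" "x $ 2 \<noteq> 0" "sin (x $ 3) \<noteq> 0"
  shows "partial l (\<lambda>y. flrw_gamma a y k i j) x = flrw_dgamma a x l k i j"
proof -
  have d: "(a has_real_derivative deriv a (x $ 1)) (at (x $ 1))"
    "(deriv a has_real_derivative deriv (deriv a) (x $ 1)) (at (x $ 1))"
    using a by (simp_all add: DERIV_deriv_iff_real_differentiable)
  have sc: "sin (x $ 3) * sin (x $ 3) + cos (x $ 3) * cos (x $ 3) = 1"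
    using sin_cos_squared_add[of "x $ 3"] by (simp add: power2_eq_square)
  have D: "((\<lambda>s. deriv a s / a s) has_real_derivative
      deriv (deriv a) (x $ 1) / a (x $ 1) - (deriv a (x $ 1))\<^sup>2 / (a (x $ 1))\<^sup>2) (at (x $ 1))"
    using nz by (auto intro!: derivative_eq_intros d simp: field_simps power2_eq_square)
  have E: "((\<lambda>s. a s * deriv a s) has_real_derivative
      (deriv a (x $ 1))\<^sup>2 + a (x $ 1) * deriv (deriv a) (x $ 1)) (at (x $ 1))"
    by (auto intro!: derivative_eq_intros d simp: field_simps power2_eq_square)
  have F: "((\<lambda>s. cos s / sin s) has_real_derivative - 1 / (sin (x $ 3))\<^sup>2) (at (x $ 3))"
    using nz sc
    by (auto intro!: derivative_eq_intros simp: divide_simps power2_eq_square)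
       (simp add: algebra_simps)?
  have sc': "(- (sin (x $ 3) * sin (x $ 3)) - cos (x $ 3) * cos (x $ 3)) / (sin (x $ 3) * sin (x $ 3))
      = - (1 / (sin (x $ 3) * sin (x $ 3)))"
    using nz sc by (simp add: divide_simps)
  have G: "((\<lambda>s. 1 / s) has_real_derivative - 1 / (x $ 2)\<^sup>2) (at (x $ 2))"
    using nz by (auto intro!: derivative_eq_intros simp: divide_simps power2_eq_square)
  have "\<forall>l k i j. partial l (\<lambda>y. flrw_gamma a y k i j) x = flrw_dgamma a x l k i j"
    unfolding forall_4
    by (intro conjI; rule partialI; simp add: flrw_gamma_def flrw_dgamma_def Let_def doubleton_eq_iff D E F G)
       (use nz in \<open>auto intro!: derivative_eq_intros d D F G simp: sc' power2_eq_square algebra_simps\<close>)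
  then show ?thesis by blast
qed

lemma flrw_ricci:
  fixes x :: point
  assumes J: "open J" and a: "\<forall>t\<in>J. a differentiable (at t)" "\<forall>t\<in>J. deriv a differentiable (at t)"
    and pos: "\<forall>t\<in>J. a t > 0" and x: "x \<in> flrw_region J"
  shows "ricci (flrw a) x =
     (let t = x $ 1; r = x $ 2; \<theta> = x $ 3; w = a t * deriv (deriv a) t + 2 * (deriv a t)\<^sup>2 in vector
     [vector [- 3 * deriv (deriv a) t / a t, 0, 0, 0],
      vector [0, w, 0, 0],
      vector [0, 0, w * r\<^sup>2, 0],
      vector [0, 0, 0, w * r\<^sup>2 * (sin \<theta>)\<^sup>2]])"
proof -
  have g: "christoffel (flrw a) y k i j = flrw_gamma a y k i j" if "y \<in> flrw_region J" for y k i j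
    by (rule flrw_christoffel)
       (use that a pos sin_nz in \<open>fastforce simp: flrw_region_def\<close>)+
  have nz: "a (x $ 1) \<noteq> 0" "x $ 2 \<noteq> 0" "sin (x $ 3) \<noteq> 0" and xJ: "x $ 1 \<in> J"
    using x pos sin_nz by (fastforce simp: flrw_region_def)+
  have dg: "partial l (\<lambda>y. christoffel (flrw a) y k i j) x = flrw_dgamma a x l k i j" for l k i j
    using partial_cong[OF open_flrw_region[OF J] x, of "\<lambda>y. christoffel (flrw a) y k i j" "\<lambda>y. flrw_gamma a y k i j" l] g
      flrw_dgamma_eq[of a x l k i j] nz xJ a by auto
  have sc: "(cos (x $ 3))\<^sup>2 = 1 - (sin (x $ 3))\<^sup>2"
    by (rule cos_squared_eq)
  show ?thesis
    unfolding ricci_def riemann_def dg g[OF x] Let_def vec_eq_iff forall_4 sum_4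
    using nz
    by (simp add: flrw_gamma_def flrw_dgamma_def Let_def doubleton_eq_iff)
       (simp add: divide_simps, simp add: power2_eq_square algebra_simps sc[unfolded power2_eq_square])
qed

lemma flrw_scalar_curvature:
  fixes x :: point
  assumes J: "open J" and a: "\<forall>t\<in>J. a differentiable (at t)" "\<forall>t\<in>J. deriv a differentiable (at t)"
    and pos: "\<forall>t\<in>J. a t > 0" and x: "x \<in> flrw_region J"
  shows "scalar_curvature (flrw a) x = flrw_scalar a (x $ 1)"
proof -
  have nz: "a (x $ 1) \<noteq> 0" "x $ 2 \<noteq> 0" "sin (x $ 3) \<noteq> 0"
    using x pos sin_nz by (fastforce simp: flrw_region_def)+
  show ?thesis
    unfolding scalar_curvature_def metric_trace_def sum_4 flrw_ricci[OF assms] flrw_inv[of a x, OF nz]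
      flrw_scalar_def Let_def
    using nz by (simp add: field_simps power2_eq_square)
qed

definition vaidya_region :: "(real \<times> real) set \<Rightarrow> point set" where
  "vaidya_region U = {x. (x $ 1, x $ 2) \<in> U \<and> 0 < x $ 3 \<and> x $ 3 < pi}"

lemma open_vaidya_region: "open U \<Longrightarrow> open (vaidya_region U)"
proof -
  assume U: "open U"
  have "vaidya_region U = ((\<lambda>x. (x $ 1, x $ 2)) -` U) \<inter> {x. 0 < x $ 3} \<inter> {x. x $ 3 < pi}"
    by (auto simp: vaidya_region_def)
  then show ?thesis using U
    by (auto intro!: open_Int open_Collect_less continuous_intros open_vimage)
qed

lemma vaidya_inv:
  assumes "x $ 2 \<noteq> 0" "sin (x $ 3) \<noteq> 0"
  shows "matrix_inv (vaidya M x) = (let v = x $ 1; r = x $ 2; \<theta> = x $ 3 in vector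
     [vector [0, 1, 0, 0],
      vector [1, 1 - 2 * M v r / r, 0, 0],
      vector [0, 0, 1 / r\<^sup>2, 0],
      vector [0, 0, 0, 1 / (r\<^sup>2 * (sin \<theta>)\<^sup>2)]])"
  using assms
  by (intro matrix_inv_eqI)
     (simp add: vaidya_def Let_def matrix_matrix_mult_def vec_eq_iff forall_4 sum_4 mat_def)

definition "vaidya_dv M x = partial 1 (\<lambda>y. vaidya M y $ 1 $ 1) x"

lemma vaidya_partial:
  fixes x :: point
  assumes "M (x $ 1) differentiable (at (x $ 2))" and nz: "x $ 2 \<noteq> 0"
  shows "partial l (\<lambda>y. vaidya M y $ i $ j) x =
    (let v = x $ 1; r = x $ 2; \<theta> = x $ 3 in
     if i \<noteq> j then 0
     else if i = 1 then
       (if l = 1 then vaidya_dv M x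
        else if l = 2 then 2 * deriv (M v) r / r - 2 * M v r / r\<^sup>2 else 0)
     else if i = 2 then 0
     else if l = 2 then 2 * r * (if i = 3 then 1 else (sin \<theta>)\<^sup>2)
     else if l = 3 then (if i = 4 then r\<^sup>2 * (2 * sin \<theta> * cos \<theta>) else 0)
     else 0)"
proof -
  have d: "(M (x $ 1) has_real_derivative deriv (M (x $ 1)) (x $ 2)) (at (x $ 2))"
    using assms by (simp add: DERIV_deriv_iff_real_differentiable)
  have "\<forall>l i j. (l, i, j) = (1, 1, 1) \<or> partial l (\<lambda>y. vaidya M y $ i $ j) x =
    (let v = x $ 1; r = x $ 2; \<theta> = x $ 3 in
     if i \<noteq> j then 0
     else if i = 1 then
       (if l = 1 then vaidya_dv M x
        else if l = 2 then 2 * deriv (M v) r / r - 2 * M v r / r\<^sup>2 else 0)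
     else if i = 2 then 0
     else if l = 2 then 2 * r * (if i = 3 then 1 else (sin \<theta>)\<^sup>2)
     else if l = 3 then (if i = 4 then r\<^sup>2 * (2 * sin \<theta> * cos \<theta>) else 0)
     else 0)"
    unfolding forall_4 prod.inject
    by (intro conjI; (simp; fail)?; rule disjI2; rule partialI; simp add: vaidya_def Let_def)
       (use nz in \<open>auto intro!: derivative_eq_intros d simp: power2_eq_square field_simps\<close>)
  then consider "(l, i, j) = (1, 1, 1)" | "?thesis" by blast
  then show ?thesis by cases (auto simp: vaidya_dv_def)
qed

definition vaidya_gamma :: "(real \<Rightarrow> real \<Rightarrow> real) \<Rightarrow> point \<Rightarrow> 4 \<Rightarrow> 4 \<Rightarrow> 4 \<Rightarrow> real" where
  "vaidya_gamma M x k i j =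
    (let v = x $ 1; r = x $ 2; \<theta> = x $ 3; q = M v r / r\<^sup>2 - deriv (M v) r / r in
     if k = 1 then
       (if i = 1 \<and> j = 1 then q
        else if i = 3 \<and> j = 3 then - r
        else if i = 4 \<and> j = 4 then - r * (sin \<theta>)\<^sup>2 else 0)
     else if k = 2 then
       (if i = 1 \<and> j = 1 then christoffel (vaidya M) x 2 1 1
        else if {i, j} = {1, 2} then - q
        else if i = 3 \<and> j = 3 then - (r - 2 * M v r)
        else if i = 4 \<and> j = 4 then - (r - 2 * M v r) * (sin \<theta>)\<^sup>2 else 0)
     else if k = 3 then
       (if {i, j} = {2, 3} then 1 / r
        else if i = 4 \<and> j = 4 then - sin \<theta> * cos \<theta> else 0)
     else
       (if {i, j} = {2, 4} then 1 / r
        else if {i, j} = {3, 4} then cos \<theta> / sin \<theta> else 0))"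

lemma vaidya_christoffel:
  fixes x :: point
  assumes M: "M (x $ 1) differentiable (at (x $ 2))"
    and nz: "x $ 2 \<noteq> 0" "sin (x $ 3) \<noteq> 0"
  shows "christoffel (vaidya M) x k i j = vaidya_gamma M x k i j"
proof -
  have "\<forall>k i j. (k, i, j) = (2, 1, 1) \<or> christoffel (vaidya M) x k i j = vaidya_gamma M x k i j"
    unfolding forall_4 christoffel_def sum_4 vaidya_partial[of M x, OF M nz(1)]
      vaidya_inv[of x M, OF nz] vaidya_gamma_def
    using nz by (simp add: Let_def doubleton_eq_iff power2_eq_square field_simps)
  moreover have "christoffel (vaidya M) x 2 1 1 = vaidya_gamma M x 2 1 1"
    by (simp add: vaidya_gamma_def)
  ultimately show ?thesis by (metis prod.inject)
qed

definition vaidya_dgamma :: "(real \<Rightarrow> real \<Rightarrow> real) \<Rightarrow> point \<Rightarrow> 4 \<Rightarrow> 4 \<Rightarrow> 4 \<Rightarrow> 4 \<Rightarrow> real" where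
  "vaidya_dgamma M x l k i j =
    (let v = x $ 1; r = x $ 2; \<theta> = x $ 3; b = deriv (M v) r; c = deriv (deriv (M v)) r;
         q = 2 * b / r\<^sup>2 - 2 * M v r / r ^ 3 - c / r in
     if k = 1 then
       (if i = 1 \<and> j = 1 then (if l = 2 then q else 0)
        else if i = 3 \<and> j = 3 then (if l = 2 then - 1 else 0)
        else if i = 4 \<and> j = 4 then (if l = 2 then - (sin \<theta>)\<^sup>2 
           else if l = 3 then - r * (2 * sin \<theta> * cos \<theta>) else 0) else 0)
     else if k = 2 then
       (if {i, j} = {1, 2} then (if l = 2 then - q else 0)
        else if i = 3 \<and> j = 3 then (if l = 2 then - (1 - 2 * b) else 0)
        else if i = 4 \<and> j = 4 then (if l = 2 then - (1 - 2 * b) * (sin \<theta>)\<^sup>2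
          else if l = 3 then - (r - 2 * M v r) * (2 * sin \<theta> * cos \<theta>) else 0) else 0)
     else if k = 3 then
       (if {i, j} = {2, 3} then (if l = 2 then - 1 / r\<^sup>2 else 0)
        else if i = 4 \<and> j = 4 then (if l = 3 then (sin \<theta>)\<^sup>2 - (cos \<theta>)\<^sup>2 else 0) else 0)
     else
       (if {i, j} = {2, 4} then (if l = 2 then - 1 / r\<^sup>2 else 0)
        else if {i, j} = {3, 4} then (if l = 3 then - 1 / (sin \<theta>)\<^sup>2 else 0) else 0))"

text \<open>The cases excluded here do not contribute to the scalar curvature.\<close>

lemma vaidya_dgamma_eq:
  fixes x :: point
  assumes M: "M (x $ 1) differentiable (at (x $ 2))" "deriv (M (x $ 1)) differentiable (at (x $ 2))"
    and nz: "x $ 2 \<noteq> 0" "sin (x $ 3) \<noteq> 0"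
    and l: "\<not> (k = 2 \<and> i = 1 \<and> j = 1)" "l \<noteq> 1 \<or> k = 3 \<or> k = 4 \<or> k = 1 \<and> \<not> (i = 1 \<and> j = 1) \<or> k = 2 \<and> i = 2 \<and> j = 2"
  shows "partial l (\<lambda>y. vaidya_gamma M y k i j) x = vaidya_dgamma M x l k i j"
proof -
  let ?ok = "\<lambda>l k i j. \<not> (k = 2 \<and> i = 1 \<and> j = 1) \<and> (l \<noteq> 1 \<or> k = 3 \<or> k = 4 \<or>
     k = 1 \<and> \<not> (i = 1 \<and> j = 1) \<or> k = 2 \<and> i = 2 \<and> j = (2::4))"
  have d: "(M (x $ 1) has_real_derivative deriv (M (x $ 1)) (x $ 2)) (at (x $ 2))"
    "(deriv (M (x $ 1)) has_real_derivative deriv (deriv (M (x $ 1))) (x $ 2)) (at (x $ 2))"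
    using M by (simp_all add: DERIV_deriv_iff_real_differentiable)
  have sc: "sin (x $ 3) * sin (x $ 3) + cos (x $ 3) * cos (x $ 3) = 1"
    using sin_cos_squared_add[of "x $ 3"] by (simp add: power2_eq_square)
  have sc': "(- (sin (x $ 3) * sin (x $ 3)) - cos (x $ 3) * cos (x $ 3)) / (sin (x $ 3) * sin (x $ 3))
      = - (1 / (sin (x $ 3) * sin (x $ 3)))"
    using nz sc by (simp add: divide_simps)
  have E: "((\<lambda>s. M (x $ 1) s / s\<^sup>2 - deriv (M (x $ 1)) s / s) has_real_derivative
      2 * deriv (M (x $ 1)) (x $ 2) / (x $ 2)\<^sup>2 - 2 * M (x $ 1) (x $ 2) / (x $ 2) ^ 3
      - deriv (deriv (M (x $ 1))) (x $ 2) / (x $ 2)) (at (x $ 2))"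
    using nz by (auto intro!: derivative_eq_intros d simp: field_simps power2_eq_square power3_eq_cube)
  have E': "((\<lambda>s. deriv (M (x $ 1)) s / s - M (x $ 1) s / s\<^sup>2) has_real_derivative
      deriv (deriv (M (x $ 1))) (x $ 2) / (x $ 2) -
      (2 * deriv (M (x $ 1)) (x $ 2) / (x $ 2)\<^sup>2 - 2 * M (x $ 1) (x $ 2) / (x $ 2) ^ 3)) (at (x $ 2))"
    using DERIV_minus[OF E] by (simp add: algebra_simps)
  have G: "((\<lambda>s. 1 / s) has_real_derivative - 1 / (x $ 2)\<^sup>2) (at (x $ 2))"
    using nz by (auto intro!: derivative_eq_intros simp: divide_simps power2_eq_square)
  have F: "((\<lambda>s. cos s / sin s) has_real_derivative - 1 / (sin (x $ 3))\<^sup>2) (at (x $ 3))"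
    using nz sc by (auto intro!: derivative_eq_intros simp: divide_simps power2_eq_square)
  have "\<forall>l k i j. ?ok l k i j \<longrightarrow> partial l (\<lambda>y. vaidya_gamma M y k i j) x = vaidya_dgamma M x l k i j"
    unfolding forall_4
    by (intro conjI; (simp; fail)?; rule impI; rule partialI;
         simp add: vaidya_gamma_def vaidya_dgamma_def Let_def doubleton_eq_iff E E' F G)
       (use nz in \<open>auto intro!: derivative_eq_intros d F G simp: sc' power2_eq_square algebra_simps\<close>)
  then show ?thesis using l by blast
qed

lemma vaidya_scalar_curvature:
  fixes x :: point
  assumes U: "open U" "\<forall>(v, r)\<in>U. r > 0"
    and M: "\<forall>(v, r)\<in>U. M v differentiable (at r)" "\<forall>(v, r)\<in>U. deriv (M v) differentiable (at r)"
    and x: "x \<in> vaidya_region U"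
  shows "scalar_curvature (vaidya M) x = vaidya_scalar M (x $ 1) (x $ 2)"
proof -
  have g: "christoffel (vaidya M) y k i j = vaidya_gamma M y k i j" if "y \<in> vaidya_region U" for y k i j
    by (rule vaidya_christoffel)
       (use that M U sin_nz in \<open>fastforce simp: vaidya_region_def\<close>)+
  have nz: "x $ 2 \<noteq> 0" "sin (x $ 3) \<noteq> 0" and xU: "(x $ 1, x $ 2) \<in> U"
    using x U sin_nz by (fastforce simp: vaidya_region_def)+
  have dg: "partial l (\<lambda>y. christoffel (vaidya M) y k i j) x = vaidya_dgamma M x l k i j"
    if "\<not> (k = 2 \<and> i = 1 \<and> j = 1)" "l \<noteq> 1 \<or> k = 3 \<or> k = 4 \<or> k = 1 \<and> \<not> (i = 1 \<and> j = 1) \<or> k = 2 \<and> i = 2 \<and> j = 2"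
    for l k i j
  proof -
    have "partial l (\<lambda>y. christoffel (vaidya M) y k i j) x = partial l (\<lambda>y. vaidya_gamma M y k i j) x"
      by (rule partial_cong[OF open_vaidya_region[OF U(1)] x g])
    also have "\<dots> = vaidya_dgamma M x l k i j"
      by (rule vaidya_dgamma_eq) (use xU M nz that in auto)
    finally show ?thesis .
  qed
  have sc: "(cos (x $ 3))\<^sup>2 = 1 - (sin (x $ 3))\<^sup>2"
    by (rule cos_squared_eq)
  have g': "christoffel (vaidya M) x k i j = vaidya_gamma M x k i j"
    if "\<not> (k = 2 \<and> i = 1 \<and> j = 1)" for k i j
    by (rule g[OF x])
  note gs = ricci_def riemann_def g' Let_def sum_4 vaidya_gamma_def vaidya_dgamma_def doubleton_eq_iff
  let ?r = "x $ 2"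
  let ?m = "M (x $ 1) ?r" let ?b = "deriv (M (x $ 1)) ?r" let ?c = "deriv (deriv (M (x $ 1))) ?r"
  let ?q = "2 * ?b / ?r\<^sup>2 - 2 * ?m / ?r ^ 3 - ?c / ?r"
  let ?e = "?m / ?r\<^sup>2 - ?b / ?r"
  have r12: "ricci (vaidya M) x $ 1 $ 2 = - ?q - 2 * ?e / ?r"
    using nz by (simp add: gs dg) (simp add: field_simps power2_eq_square power3_eq_cube)?
  have r21: "ricci (vaidya M) x $ 2 $ 1 = - ?q - 2 * ?e / ?r"
    using nz by (simp add: gs dg) (simp add: field_simps power2_eq_square power3_eq_cube)?
  have r22: "ricci (vaidya M) x $ 2 $ 2 = 0"
    using nz by (simp add: gs dg) (simp add: field_simps power2_eq_square power3_eq_cube)?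
  have r33: "ricci (vaidya M) x $ 3 $ 3 = 2 * ?b"
    using nz by (simp add: gs dg) (simp add: divide_simps, simp add: sc power2_eq_square power3_eq_cube algebra_simps sc[unfolded power2_eq_square])?
  have r44: "ricci (vaidya M) x $ 4 $ 4 = 2 * ?b * (sin (x $ 3))\<^sup>2"
    using nz by (simp add: gs dg) (simp add: divide_simps, simp add: sc power2_eq_square power3_eq_cube algebra_simps sc[unfolded power2_eq_square])?
  show ?thesis
    unfolding scalar_curvature_def metric_trace_def sum_4 vaidya_inv[of x M, OF nz] vaidya_scalar_def Let_def
    using nz by (simp add: r12 r21 r22 r33 r44) (simp add: field_simps power2_eq_square power3_eq_cube)
qed

end

(* On the matching hypersurface the vanishing of A makes f'(R_+) independent of r_v on the exterior
   side, so the r_v-derivative of R_+ vanishes there because f''(R_-) is nonzero, and (M6) then kills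
   the v-derivative too. By the chain rule R_- is constant along the hypersurface. A constant
   curvature scalar removes the derivative terms from the field equations; their trace fixes
   3 p - rho, which turns the continuity equation into ((rho + T0/4) a^4)' = 0. *)
theory Submission
  imports Defs
begin

section \<open>Smoothness and derivatives along curves\<close>

lemma smooth_on_imp_differentiable:
  assumes "smooth_on S f" "x \<in> S"
  shows "f differentiable (at x)"
proof -
  have "Ck_on (Suc 0) S f" using assms(1) unfolding smooth_on_def by blast
  then show ?thesis using assms(2) by simp
qed

lemma smooth_on_frechet_derivative:
  assumes "smooth_on S f" "b \<in> Basis"
  shows "smooth_on S (\<lambda>x. frechet_derivative f (at x) b)"
  unfolding smooth_on_def
proof
  fix k
  have "Ck_on (Suc k) S f" using assms(1) unfolding smooth_on_def by blast
  then show "Ck_on k S (\<lambda>x. frechet_derivative f (at x) b)" using assms(2) by simp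
qed

lemma differentiable_transform_open:
  assumes "F differentiable (at x)" "open S" "x \<in> S" "\<And>y. y \<in> S \<Longrightarrow> F y = G y"
  shows "G differentiable (at x)"
  using assms has_derivative_transform_within_open unfolding differentiable_def by blast

text \<open>\<open>smooth_on\<close> speaks of Frechet derivatives in basis directions. On the real
  line the only direction is 1, where that derivative is \<open>deriv\<close>.\<close>

lemma smooth_on_deriv_differentiable:
  fixes f :: "real \<Rightarrow> real"
  assumes "smooth_on S f" "open S" "x \<in> S"
  shows "deriv f differentiable (at x)"
proof (rule differentiable_transform_open)
  show "(\<lambda>y. frechet_derivative f (at y) 1) differentiable (at x)"
    using assms by (intro smooth_on_imp_differentiable[OF smooth_on_frechet_derivative]) auto
  show "frechet_derivative f (at y) 1 = deriv f y" if "y \<in> S" for y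
  proof -
    have "(f has_real_derivative deriv f y) (at y)"
      using smooth_on_imp_differentiable[OF assms(1) that]
      by (simp add: DERIV_deriv_iff_real_differentiable)
    then have "(f has_derivative (*) (deriv f y)) (at y)"
      by (simp add: has_field_derivative_def)
    from frechet_derivative_at[OF this] show ?thesis by (metis mult.right_neutral)
  qed
qed (use assms in auto)

text \<open>Chain rule in the plane: linearity splits the derivative at the velocity
  \<open>(X', Y')\<close> into its two partials. It serves both for the coordinate lines and for the
  matching hypersurface.\<close>

lemma has_real_derivative_along_curve:
  fixes F :: "real \<times> real \<Rightarrow> real"
  assumes F: "F differentiable (at (X t, Y t))"
    and X: "(X has_real_derivative X') (at t)" and Y: "(Y has_real_derivative Y') (at t)"
  shows "((\<lambda>s. F (X s, Y s)) has_real_derivative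
     X' * frechet_derivative F (at (X t, Y t)) (1, 0)
     + Y' * frechet_derivative F (at (X t, Y t)) (0, 1)) (at t)"
proof -
  let ?D = "frechet_derivative F (at (X t, Y t))"
  have D: "(F has_derivative ?D) (at (X t, Y t))"
    using F by (simp add: frechet_derivative_works)
  interpret D: linear ?D using D by (rule has_derivative_linear)
  have "((\<lambda>s. (X s, Y s)) has_derivative (\<lambda>h. (X' * h, Y' * h))) (at t)"
    using X Y by (auto intro!: has_derivative_Pair simp: has_field_derivative_def)
  from has_derivative_compose[OF this D]
  have "((\<lambda>s. F (X s, Y s)) has_derivative (\<lambda>h. ?D (X' * h, Y' * h))) (at t)" .
  moreover have "?D (X' * h, Y' * h) = (X' * ?D (1, 0) + Y' * ?D (0, 1)) * h" for h
  proof -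
    have "(X' * h, Y' * h) = (X' * h) *\<^sub>R (1, 0) + (Y' * h) *\<^sub>R (0, 1)" by simp
    then have "?D (X' * h, Y' * h) = (X' * h) *\<^sub>R ?D (1, 0) + (Y' * h) *\<^sub>R ?D (0, 1)"
      by (simp only: D.add D.scaleR)
    then show ?thesis by (simp add: algebra_simps)
  qed
  ultimately show ?thesis by (simp add: has_field_derivative_def)
qed

lemma has_real_derivative_fst:
  fixes F :: "real \<times> real \<Rightarrow> real"
  assumes "F differentiable (at (v, r))"
  shows "((\<lambda>s. F (s, r)) has_real_derivative frechet_derivative F (at (v, r)) (1, 0)) (at v)"
  using has_real_derivative_along_curve[of F "\<lambda>s. s" v "\<lambda>_. r" 1 0] assms by simp

lemma has_real_derivative_snd:
  fixes F :: "real \<times> real \<Rightarrow> real"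
  assumes "F differentiable (at (v, r))"
  shows "((\<lambda>s. F (v, s)) has_real_derivative frechet_derivative F (at (v, r)) (0, 1)) (at r)"
  using has_real_derivative_along_curve[of F "\<lambda>_. v" r "\<lambda>s. s" 0 1] assms by simp

text \<open>Slices of open sets are open. This turns identities on \<open>U\<close> into identities
  near \<open>r\<close> that may be differentiated in the second variable alone.\<close>

lemma eventually_vertical_slice:
  fixes U :: "(real \<times> real) set"
  assumes "open U" "(v, r) \<in> U"
  shows "eventually (\<lambda>s. (v, s) \<in> U) (nhds r)"
proof -
  have "open ((\<lambda>s. (v, s)) -` U)"
    using assms(1) by (intro open_vimage continuous_intros)
  then show ?thesis
    using eventually_nhds_in_open[of "(\<lambda>s. (v, s)) -` U" r] assms(2) by simp
qed

text \<open>The exterior lies on one side of the hypersurface, so constancy is known only to the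
  right of \<open>r\<close>. A two-sided derivative equals the right-hand one, whose difference
  quotients are eventually 0.\<close>

lemma has_real_derivative_zero_if_const_right:
  fixes h :: "real \<Rightarrow> real"
  assumes h: "(h has_real_derivative D) (at r)"
    and const: "eventually (\<lambda>s. s \<ge> r \<longrightarrow> h s = c) (nhds r)"
  shows "D = 0"
proof -
  have r: "h r = c" using eventually_nhds_x_imp_x[OF const] by simp
  have "(h has_real_derivative D) (at_right r)"
    using h by (rule DERIV_subset[OF _ subset_UNIV])
  then have lim: "((\<lambda>s. (h s - h r) / (s - r)) \<longlongrightarrow> D) (at_right r)"
    by (simp add: has_field_derivative_iff)
  have "eventually (\<lambda>s. s \<ge> r \<longrightarrow> h s = c) (at_right r)"
    using const by (auto simp: eventually_at_filter elim: eventually_mono)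
  then have "eventually (\<lambda>s. (h s - h r) / (s - r) = 0) (at_right r)"
    using eventually_at_right_less[of r] by eventually_elim (simp add: r)
  then have "((\<lambda>s. (h s - h r) / (s - r)) \<longlongrightarrow> 0) (at_right r)"
    by (rule tendsto_eventually)
  with lim show ?thesis using tendsto_unique trivial_limit_at_right_real by blast
qed

text \<open>A zero derivative alone gives only local constancy; an interval is convex, so a single
  constant serves all of \<open>J\<close>.\<close>

lemma zero_derivative_constant_on_interval:
  fixes h :: "real \<Rightarrow> real"
  assumes "open J" "is_interval J" "\<And>t. t \<in> J \<Longrightarrow> (h has_real_derivative 0) (at t)"
  shows "\<exists>c. \<forall>t\<in>J. h t = c"
proof -
  have "convex J" using assms(2) by (simp add: is_interval_convex)
  then obtain c where "\<And>t. t \<in> J \<Longrightarrow> h t = c"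
    using has_field_derivative_zero_constant[of J h] assms(3) DERIV_subset[OF _ subset_UNIV] by metis
  then show ?thesis by blast
qed

section \<open>Differentiability of the exterior Ricci scalar\<close>

lemma smooth_mass_r_derivatives:
  fixes M :: "real \<Rightarrow> real \<Rightarrow> real"
  assumes U: "open U" and M: "smooth_on U (\<lambda>(v, r). M v r)" and vr: "(v, r) \<in> U"
  shows "M v differentiable (at r)" "deriv (M v) differentiable (at r)"
    and "(\<lambda>x. deriv (M (fst x)) (snd x)) differentiable (at (v, r))"
    and "(\<lambda>x. deriv (deriv (M (fst x))) (snd x)) differentiable (at (v, r))"
proof -
  \<comment> \<open>\<open>G\<close> and \<open>H\<close> are the first and second partials of the
    mass in its second variable, jointly smooth on \<open>U\<close>. Identifying them there with the
    iterated \<open>deriv\<close> transfers joint differentiability to the latter.\<close>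
  define F where "F = (\<lambda>(v, r). M v r)"
  define G where "G = (\<lambda>x. frechet_derivative F (at x) (0, 1))"
  define H where "H = (\<lambda>x. frechet_derivative G (at x) (0, 1))"
  have b: "(0, 1) \<in> (Basis :: (real \<times> real) set)" by (simp add: Basis_prod_def)
  have sF: "smooth_on U F" using M by (simp add: F_def)
  then have sG: "smooth_on U G" unfolding G_def by (rule smooth_on_frechet_derivative[OF _ b])
  then have sH: "smooth_on U H" unfolding H_def by (rule smooth_on_frechet_derivative[OF _ b])
  have dM: "(M v has_real_derivative G (v, r)) (at r)" if "(v, r) \<in> U" for v r
    using has_real_derivative_snd[OF smooth_on_imp_differentiable[OF sF that]]
    by (simp add: F_def G_def)
  have G: "deriv (M v) r = G (v, r)" if "(v, r) \<in> U" for v r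
    using dM[OF that] by (rule DERIV_imp_deriv)
  have dG: "(deriv (M v) has_real_derivative H (v, r)) (at r)" if "(v, r) \<in> U" for v r
  proof -
    have "((\<lambda>s. G (v, s)) has_real_derivative H (v, r)) (at r)"
      using has_real_derivative_snd[OF smooth_on_imp_differentiable[OF sG that]]
      by (simp add: H_def)
    \<comment> \<open>Differentiating once more requires agreement on a whole neighbourhood of
      \<open>r\<close>.\<close>
    moreover have "eventually (\<lambda>s. deriv (M v) s = G (v, s)) (nhds r)"
      using eventually_vertical_slice[OF U that] by (rule eventually_mono) (rule G)
    ultimately show ?thesis by (subst DERIV_cong_ev[OF refl _ refl])
  qed
  have H: "deriv (deriv (M v)) r = H (v, r)" if "(v, r) \<in> U" for v r
    using dG[OF that] by (rule DERIV_imp_deriv)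
  show "M v differentiable (at r)" "deriv (M v) differentiable (at r)"
    using dM[OF vr] dG[OF vr] by (auto simp: real_differentiable_def)
  show "(\<lambda>x. deriv (M (fst x)) (snd x)) differentiable (at (v, r))"
    by (rule differentiable_transform_open[OF smooth_on_imp_differentiable[OF sG vr] U vr])
      (simp add: G)
  show "(\<lambda>x. deriv (deriv (M (fst x))) (snd x)) differentiable (at (v, r))"
    by (rule differentiable_transform_open[OF smooth_on_imp_differentiable[OF sH vr] U vr])
      (simp add: H)
qed

lemma vaidya_scalar_differentiable:
  fixes M :: "real \<Rightarrow> real \<Rightarrow> real"
  assumes U: "open U" and M: "smooth_on U (\<lambda>(v, r). M v r)" and vr: "(v, r) \<in> U" "r \<noteq> 0"
  shows "(\<lambda>x. vaidya_scalar M (fst x) (snd x)) differentiable (at (v, r))"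
proof -
  have snd: "snd differentiable (at (v, r))"
    by (rule bounded_linear_imp_differentiable[OF bounded_linear_snd])
  show ?thesis
    unfolding vaidya_scalar_def
    by (intro differentiable_mult differentiable_add differentiable_divide differentiable_power
        differentiable_const snd smooth_mass_r_derivatives[OF U M vr(1)]) (use vr in simp)
qed

section \<open>Field equations at constant curvature\<close>

lemma partial_const: "partial i (\<lambda>_. c) = (\<lambda>_. 0)"
  by (simp add: partial_def fun_eq_iff)

text \<open>First partials vanish on all of the open set, hence so do second partials at
  \<open>x\<close>; the Christoffel terms carry a first partial as a factor.\<close>

lemma hessian_locally_const:
  assumes "open S" "x \<in> S" "\<And>y. y \<in> S \<Longrightarrow> \<phi> y = c"
  shows "hessian g \<phi> x = 0"
proof -
  have d: "partial j \<phi> y = 0" if "y \<in> S" for j y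
    using partial_cong[OF assms(1) that, of \<phi> "\<lambda>_. c"] assms(3) by (simp add: partial_const)
  have "partial i (partial j \<phi>) x = 0" for i j
    using partial_cong[OF assms(1,2), of "partial j \<phi>" "\<lambda>_. 0"] d by (simp add: partial_const)
  then show ?thesis by (simp add: hessian_def vec_eq_iff d[OF assms(2)])
qed

text \<open>The derivative terms of \<open>deriv f\<close> of the scalar curvature drop out.
  Substituting Ricci = Einstein + (R0/2) g in the rest gives the coefficient of g.\<close>

lemma fR_tensor_const_curvature:
  assumes S: "open S" "x \<in> S" and R: "\<And>y. y \<in> S \<Longrightarrow> scalar_curvature g y = R0"
  shows "fR_tensor f g x =
     deriv f R0 *\<^sub>R einstein g x + ((deriv f R0 * R0 - f R0) / 2) *\<^sub>R g x"
proof -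
  let ?\<phi> = "\<lambda>y. deriv f (scalar_curvature g y)"
  have h: "hessian g ?\<phi> x = 0" by (rule hessian_locally_const[OF S]) (simp add: R)
  then have "dalembertian g ?\<phi> x = 0" by (simp add: dalembertian_def metric_trace_def)
  with h show ?thesis
    by (simp add: fR_tensor_def Let_def einstein_def R[OF S(2)] vec_eq_iff field_simps)
qed

section \<open>Traces in the interior metric\<close>

lemma metric_trace_add: "metric_trace g x (S + S') = metric_trace g x S + metric_trace g x S'"
  by (simp add: metric_trace_def sum.distrib algebra_simps)

lemma metric_trace_scaleR: "metric_trace g x (c *\<^sub>R S) = c * metric_trace g x S"
  by (simp add: metric_trace_def sum_distrib_left algebra_simps)

lemma flrw_metric_trace_self:
  assumes "a (x $ 1) \<noteq> 0" "x $ 2 \<noteq> 0" "sin (x $ 3) \<noteq> 0"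
  shows "metric_trace (flrw a) x (flrw a x) = 4"
  unfolding metric_trace_def flrw_inv[of a x, OF assms] sum_4
  using assms by (simp add: flrw_def Let_def)

text \<open>In dimension 4 the trace is R - (R/2) * 4 = -R.\<close>

lemma flrw_metric_trace_einstein:
  assumes "a (x $ 1) \<noteq> 0" "x $ 2 \<noteq> 0" "sin (x $ 3) \<noteq> 0"
  shows "metric_trace (flrw a) x (einstein (flrw a) x) = - scalar_curvature (flrw a) x"
proof -
  have "einstein (flrw a) x
      = ricci (flrw a) x + (- (scalar_curvature (flrw a) x / 2)) *\<^sub>R flrw a x"
    by (simp add: einstein_def)
  then show ?thesis
    by (simp only: metric_trace_add metric_trace_scaleR flrw_metric_trace_self[of a x, OF assms])
       (simp add: scalar_curvature_def)
qed

text \<open>The comoving velocity has norm -1, so the trace is -(\<rho> + p) + 4 p.\<close>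

lemma flrw_metric_trace_perfect_fluid:
  assumes "a (x $ 1) \<noteq> 0" "x $ 2 \<noteq> 0" "sin (x $ 3) \<noteq> 0"
  shows "metric_trace (flrw a) x (perfect_fluid (flrw a) comoving \<rho> p x) = - \<rho> + 3 * p"
  unfolding metric_trace_def flrw_inv[of a x, OF assms] sum_4
  using assms
  by (simp add: flrw_def Let_def perfect_fluid_def comoving_def matrix_vector_mult_def sum_4)

text \<open>The curvature formula holds on \<open>flrw_region J\<close>, which is known to be open
  when \<open>J\<close> is; the interior inherits it together with a neighbourhood of each
  point.\<close>

lemma interior_region_subset: "interior_region J r0 \<subseteq> flrw_region J"
  by (auto simp: interior_region_def flrw_region_def)

text \<open>Lets a pointwise identity on the interior be read as one in \<open>t\<close>; the
  witness takes the midpoints of the other coordinate ranges.\<close>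

lemma interior_region_point:
  assumes "t \<in> J" "r0 > 0"
  obtains x where "x \<in> interior_region J r0" "x $ 1 = t"
proof
  show "vector [t, r0 / 2, pi / 2, pi] \<in> interior_region J r0"
    using assms by (simp add: interior_region_def)
qed simp

theorem mainTheorem9:
  fixes f a T Rb A B :: "real \<Rightarrow> real"
    and M :: "real \<Rightarrow> real \<Rightarrow> real"
    and J :: "real set" and U :: "(real \<times> real) set"
    and r0 \<kappa> Gn :: real
  assumes kappa: "\<kappa> = 8 * pi * Gn" "\<kappa> > 0"
    and f: "smooth_on UNIV f"
    and r0: "r0 > 0"
    and J: "open J" "is_interval J"
    and a: "smooth_on J a" "\<forall>t\<in>J. a t > 0" "\<forall>t\<in>J. 1 - r0 * deriv a t \<noteq> 0"
    and U: "open U" "\<forall>(v, r)\<in>U. r > 0" "\<forall>t\<in>J. (T t, Rb t) \<in> U"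
    and M: "smooth_on U (\<lambda>(v, r). M v r)"
    and M1: "\<forall>t\<in>J. Rb t = r0 * a t"
    and M2: "\<forall>t\<in>J. (T has_real_derivative 1 / (1 - r0 * deriv a t)) (at t)"
    and M3: "\<forall>t\<in>J. M (T t) (Rb t) = r0 ^ 3 / 2 * a t * (deriv a t)\<^sup>2"
    and M4: "\<forall>t\<in>J. deriv (M (T t)) (Rb t) =
               r0\<^sup>2 * ((deriv a t)\<^sup>2 / 2 + a t * deriv (deriv a) t)"
    and M5: "\<forall>t\<in>J. vaidya_scalar M (T t) (Rb t) = flrw_scalar a t"
    and M6: "\<forall>t\<in>J. deriv (\<lambda>v. vaidya_scalar M v (Rb t)) (T t)
               + (1 - deriv Rb t) * deriv (vaidya_scalar M (T t)) (Rb t) = 0"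
    and AB: "smooth_on (T ` J) A" "smooth_on (T ` J) B"
    and exterior: "\<forall>x\<in>exterior_region U J T Rb.
               deriv f (scalar_curvature (vaidya M) x) = A (x $ 1) * x $ 2 + B (x $ 1)"
    and fRR: "\<forall>t\<in>J. deriv (deriv f) (flrw_scalar a t) \<noteq> 0"
    and A0: "\<forall>t\<in>J. A (T t) = 0"
  shows "\<exists>R0. (\<forall>t\<in>J. flrw_scalar a t = R0) \<and>
    (\<forall>\<rho> p :: real \<Rightarrow> real.
       (let g = flrw a;
            Tm = (\<lambda>x. perfect_fluid g comoving (\<rho> (x $ 1)) (p (x $ 1)) x);
            fR = deriv f R0
        in
        (\<forall>x\<in>interior_region J r0. fR_tensor f g x = \<kappa> *\<^sub>R Tm x) \<longrightarrow>
        (\<forall>t\<in>J. \<rho> differentiable (at t) \<and>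
               deriv \<rho> t + 3 * (deriv a t / a t) * (\<rho> t + p t) = 0) \<longrightarrow>
        (\<forall>x\<in>interior_region J r0.
            fR_tensor f g x = fR *\<^sub>R einstein g x + ((fR * R0 - f R0) / 2) *\<^sub>R g x \<and>
            fR *\<^sub>R einstein g x + ((fR * R0 - f R0) / 2) *\<^sub>R g x = \<kappa> *\<^sub>R Tm x) \<and>
        (\<exists>T0.
            (\<forall>x\<in>interior_region J r0.
               metric_trace g x (Tm x) = - \<rho> (x $ 1) + 3 * p (x $ 1) \<and>
               metric_trace g x (Tm x) = T0) \<and>
            \<kappa> * T0 = fR * R0 - 2 * f R0 \<and>
            (\<forall>t\<in>J. p t = (\<rho> t + T0) / 3) \<and>
            (\<exists>C. \<forall>t\<in>J. \<rho> t = C / (a t) ^ 4 - T0 / 4 \<and>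
                        p t = C / (3 * (a t) ^ 4) + T0 / 4)) \<and>
        ((\<forall>t\<in>J. p t = 0 \<and> \<rho> t > 0) \<longrightarrow>
            (\<exists>\<rho>0. \<forall>t\<in>J. \<rho> t = \<rho>0) \<and> (\<forall>t\<in>J. deriv a t = 0))))"
proof -

  \<comment> \<open>Constancy of the interior Ricci scalar\<close>
  have da: "(a has_real_derivative deriv a t) (at t)" if "t \<in> J" for t
    using smooth_on_imp_differentiable[OF a(1) that] by (simp add: DERIV_deriv_iff_real_differentiable)
  have a_diff: "\<forall>t\<in>J. a differentiable (at t)" "\<forall>t\<in>J. deriv a differentiable (at t)"
    using smooth_on_imp_differentiable[OF a(1)] smooth_on_deriv_differentiable[OF a(1) J(1)] by auto
  define W where "W = (\<lambda>x. vaidya_scalar M (fst x) (snd x))"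
  have "(flrw_scalar a has_real_derivative 0) (at t)" if t: "t \<in> J" for t
  proof -
    let ?p = "(T t, Rb t)"
    have pU: "?p \<in> U" and Rpos: "Rb t > 0" using U t by auto
    have W: "W differentiable (at ?p)"
      unfolding W_def by (rule vaidya_scalar_differentiable[OF U(1) M pU]) (use Rpos in simp)
    let ?Wv = "frechet_derivative W (at ?p) (1, 0)" and ?Wr = "frechet_derivative W (at ?p) (0, 1)"
    have dv: "((\<lambda>v. vaidya_scalar M v (Rb t)) has_real_derivative ?Wv) (at (T t))"
      using has_real_derivative_fst[OF W] by (simp add: W_def)
    have dr: "(vaidya_scalar M (T t) has_real_derivative ?Wr) (at (Rb t))"
      using has_real_derivative_snd[OF W] by (simp add: W_def)
    \<comment> \<open>\<open>M5\<close> moves the second derivative of \<open>f\<close> to the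
      interior curvature, where it is assumed nonzero.\<close>
    have "(deriv f has_real_derivative deriv (deriv f) (flrw_scalar a t)) (at (vaidya_scalar M (T t) (Rb t)))"
      using smooth_on_deriv_differentiable[OF f] M5 t by (simp add: DERIV_deriv_iff_real_differentiable)
    from DERIV_chain2[OF this dr]
    have "((\<lambda>s. deriv f (vaidya_scalar M (T t) s)) has_real_derivative
        deriv (deriv f) (flrw_scalar a t) * ?Wr) (at (Rb t))" .
    \<comment> \<open>On the ray from the hypersurface into the exterior at fixed
      \<open>v = T t\<close>, the linear term has coefficient \<open>A (T t) = 0\<close>.\<close>
    moreover have "eventually (\<lambda>s. s \<ge> Rb t \<longrightarrow> deriv f (vaidya_scalar M (T t) s) = B (T t)) (nhds (Rb t))"
      using eventually_vertical_slice[OF U(1) pU]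
    proof (rule eventually_mono, intro impI)
      fix s assume s: "(T t, s) \<in> U" "s \<ge> Rb t"
      \<comment> \<open>The angles are interior values of their ranges, so that the point lies in
        the chart; the scalar curvature depends only on the first two coordinates.\<close>
      let ?x = "vector [T t, s, pi / 2, pi] :: point"
      have "?x \<in> vaidya_region U" "?x \<in> exterior_region U J T Rb"
        using s t by (auto simp: vaidya_region_def exterior_region_def)
      then show "deriv f (vaidya_scalar M (T t) s) = B (T t)"
        using vaidya_scalar_curvature[OF U(1,2), of M ?x] smooth_mass_r_derivatives[OF U(1) M]
          exterior A0 t by fastforce
    qed
    ultimately have Wr: "?Wr = 0"
      using has_real_derivative_zero_if_const_right fRR t by fastforce
    \<comment> \<open>With \<open>?Wr = 0\<close>, only the partial in \<open>v\<close> survives in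
      \<open>M6\<close>.\<close>
    then have Wv: "?Wv = 0"
      using bspec[OF M6 t] DERIV_imp_deriv[OF dv] DERIV_imp_deriv[OF dr] by simp
    have "((\<lambda>s. r0 * a s) has_real_derivative r0 * deriv a t) (at t)"
      by (rule DERIV_cmult[OF da[OF t]])
    then have "(Rb has_real_derivative r0 * deriv a t) (at t)"
      by (rule has_field_derivative_transform_within_open[OF _ J(1) t]) (use M1 in simp)
    \<comment> \<open>Both partials of the exterior scalar vanish on the hypersurface, so its
      tangential derivative does; by \<open>M5\<close> that is the derivative of the interior
      scalar.\<close>
    from has_real_derivative_along_curve[where F = W, OF W M2[rule_format, OF t] this]
    have "((\<lambda>s. W (T s, Rb s)) has_real_derivative 0) (at t)" by (simp add: Wr Wv)
    then show ?thesis
      by (rule has_field_derivative_transform_within_open[OF _ J(1) t]) (use M5 in \<open>simp add: W_def\<close>)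
  qed
  then obtain R0 where R0: "\<forall>t\<in>J. flrw_scalar a t = R0"
    using zero_derivative_constant_on_interval[OF J] by blast

  \<comment> \<open>Reduced field equations and their consequences for a perfect fluid\<close>
  define fR where "fR = deriv f R0"
  define g where "g = flrw a"
  \<comment> \<open>The value forced by the trace of the reduced equations.\<close>
  define T0 where "T0 = (fR * R0 - 2 * f R0) / \<kappa>"
  have kT0: "\<kappa> * T0 = fR * R0 - 2 * f R0" using kappa(2) by (simp add: T0_def)
  have R: "scalar_curvature g x = R0" if "x \<in> flrw_region J" for x
    using flrw_scalar_curvature[OF J(1) a_diff a(2) that] R0 that by (simp add: g_def flrw_region_def)
  have red: "fR_tensor f g x = fR *\<^sub>R einstein g x + ((fR * R0 - f R0) / 2) *\<^sub>R g x"
    if "x \<in> interior_region J r0" for x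
    using fR_tensor_const_curvature[OF open_flrw_region[OF J(1)] _ R] subsetD[OF interior_region_subset that]
    by (simp add: fR_def)
  have nz: "a (x $ 1) \<noteq> 0 \<and> x $ 2 \<noteq> 0 \<and> sin (x $ 3) \<noteq> 0" if "x \<in> interior_region J r0" for x
    using that a(2) sin_nz by (fastforce simp: interior_region_def)
  have main: "(\<forall>x\<in>interior_region J r0.
            fR_tensor f g x = fR *\<^sub>R einstein g x + ((fR * R0 - f R0) / 2) *\<^sub>R g x \<and>
            fR *\<^sub>R einstein g x + ((fR * R0 - f R0) / 2) *\<^sub>R g x = \<kappa> *\<^sub>R Tm x) \<and>
        (\<exists>T0.
            (\<forall>x\<in>interior_region J r0.
               metric_trace g x (Tm x) = - \<rho> (x $ 1) + 3 * p (x $ 1) \<and>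
               metric_trace g x (Tm x) = T0) \<and>
            \<kappa> * T0 = fR * R0 - 2 * f R0 \<and>
            (\<forall>t\<in>J. p t = (\<rho> t + T0) / 3) \<and>
            (\<exists>C. \<forall>t\<in>J. \<rho> t = C / (a t) ^ 4 - T0 / 4 \<and>
                        p t = C / (3 * (a t) ^ 4) + T0 / 4)) \<and>
        ((\<forall>t\<in>J. p t = 0 \<and> \<rho> t > 0) \<longrightarrow>
            (\<exists>\<rho>0. \<forall>t\<in>J. \<rho> t = \<rho>0) \<and> (\<forall>t\<in>J. deriv a t = 0))"
    if Tm: "Tm = (\<lambda>x. perfect_fluid g comoving (\<rho> (x $ 1)) (p (x $ 1)) x)"
      and field: "\<forall>x\<in>interior_region J r0. fR_tensor f g x = \<kappa> *\<^sub>R Tm x"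
      and cont: "\<forall>t\<in>J. \<rho> differentiable (at t) \<and> deriv \<rho> t + 3 * (deriv a t / a t) * (\<rho> t + p t) = 0"
    for \<rho> p Tm
  proof -
    have d\<rho>: "(\<rho> has_real_derivative deriv \<rho> t) (at t)" if "t \<in> J" for t
      using cont that by (simp add: DERIV_deriv_iff_real_differentiable)
    have tr: "metric_trace g x (Tm x) = - \<rho> (x $ 1) + 3 * p (x $ 1)" if "x \<in> interior_region J r0" for x
      using flrw_metric_trace_perfect_fluid nz[OF that] by (simp add: Tm g_def)
    have trT0: "metric_trace g x (Tm x) = T0" if x: "x \<in> interior_region J r0" for x
    proof -
      have "\<kappa> * metric_trace g x (Tm x)
          = metric_trace g x (fR *\<^sub>R einstein g x + ((fR * R0 - f R0) / 2) *\<^sub>R g x)"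
        using red[OF x] field x metric_trace_scaleR[of g x \<kappa> "Tm x"] by simp
      \<comment> \<open>The Einstein tensor contributes \<open>- R0\<close>, and the metric has
        trace 4.\<close>
      also have "\<dots> = - fR * R0 + 2 * (fR * R0 - f R0)"
        using flrw_metric_trace_einstein[of a x] flrw_metric_trace_self[of a x] nz[OF x]
          R[OF subsetD[OF interior_region_subset x]]
        by (simp add: metric_trace_add metric_trace_scaleR g_def field_simps)
      also have "\<dots> = \<kappa> * T0" using kT0 by simp
      finally show ?thesis using kappa(2) by simp
    qed
    have p: "p t = (\<rho> t + T0) / 3" if t: "t \<in> J" for t
    proof -
      obtain x where x: "x \<in> interior_region J r0" "x $ 1 = t"
        using interior_region_point[OF t r0] .
      show ?thesis using tr[OF x(1)] trT0[OF x(1)] x(2) by simp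
    qed
    \<comment> \<open>Inserting \<open>p\<close> turns the continuity equation into a linear one,
      \<rho>' + (a'/a) (4 \<rho> + T0) = 0, with equilibrium -T0/4 and integrating factor
      a^4.\<close>
    have "((\<lambda>s. (\<rho> s + T0 / 4) * a s ^ 4) has_real_derivative 0) (at t)" if t: "t \<in> J" for t
    proof -
      have pos: "a t > 0" using a(2) t by simp
      have "deriv \<rho> t = - (deriv a t / a t) * (4 * \<rho> t + T0)"
        using cont t p[OF t] by (auto simp: algebra_simps add_divide_distrib)
      then have "deriv \<rho> t * a t + (4 * \<rho> t + T0) * deriv a t = 0"
        using pos by (simp add: field_simps)
      moreover have "deriv \<rho> t * a t ^ 4 + (\<rho> t + T0 / 4) * (4 * a t ^ 3 * deriv a t)
          = a t ^ 3 * (deriv \<rho> t * a t + (4 * \<rho> t + T0) * deriv a t)"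
        by (simp add: algebra_simps power4_eq_xxxx power3_eq_cube)
      ultimately have "deriv \<rho> t * a t ^ 4 + (\<rho> t + T0 / 4) * (4 * a t ^ 3 * deriv a t) = 0"
        by simp
      then show ?thesis
        by (auto intro!: derivative_eq_intros d\<rho> da t simp: algebra_simps)
    qed
    then obtain C where C: "\<forall>t\<in>J. (\<rho> t + T0 / 4) * a t ^ 4 = C"
      using zero_derivative_constant_on_interval[OF J] by blast
    have \<rho>: "\<rho> t = C / a t ^ 4 - T0 / 4" if "t \<in> J" for t
    proof -
      have "a t ^ 4 \<noteq> 0" using a(2) that by auto
      then show ?thesis using C that by (auto simp: field_simps)
    qed
    have p': "p t = C / (3 * a t ^ 4) + T0 / 4" if "t \<in> J" for t
      using p[OF that] \<rho>[OF that] by (simp add: field_simps)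
    have dust: "(\<exists>\<rho>0. \<forall>t\<in>J. \<rho> t = \<rho>0) \<and> (\<forall>t\<in>J. deriv a t = 0)"
      if d: "\<forall>t\<in>J. p t = 0 \<and> \<rho> t > 0"
    proof (intro conjI ballI exI)
      \<comment> \<open>Zero pressure in \<open>p = (\<rho> + T0) / 3\<close> already fixes the
        density.\<close>
      show const: "\<rho> t = - T0" if "t \<in> J" for t using p[OF that] d that by simp
      fix t assume t: "t \<in> J"
      have "(\<rho> has_real_derivative 0) (at t)"
        by (rule has_field_derivative_transform_within_open[OF DERIV_const[of "- T0"] J(1) t])
          (simp add: const)
      then have "deriv \<rho> t = 0" by (rule DERIV_imp_deriv)
      \<comment> \<open>With constant density and zero pressure the continuity equation leaves only
        the expansion term; positivity of \<rho> and \<open>a\<close> then forces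
        \<open>deriv a t = 0\<close>.\<close>
      then have "3 * (deriv a t / a t) * \<rho> t = 0" using cont d t by auto
      moreover have "\<rho> t \<noteq> 0" "a t \<noteq> 0" using d a(2) t by fastforce+
      ultimately show "deriv a t = 0" by simp
    qed
    have "\<exists>T0. (\<forall>x\<in>interior_region J r0.
               metric_trace g x (Tm x) = - \<rho> (x $ 1) + 3 * p (x $ 1) \<and>
               metric_trace g x (Tm x) = T0) \<and>
            \<kappa> * T0 = fR * R0 - 2 * f R0 \<and>
            (\<forall>t\<in>J. p t = (\<rho> t + T0) / 3) \<and>
            (\<exists>C. \<forall>t\<in>J. \<rho> t = C / (a t) ^ 4 - T0 / 4 \<and>
                        p t = C / (3 * (a t) ^ 4) + T0 / 4)"
      by (intro exI[of _ T0] exI[of _ C] conjI ballI) (assumption | rule tr trT0 kT0 p \<rho> p')+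
    moreover have "\<forall>x\<in>interior_region J r0.
        fR_tensor f g x = fR *\<^sub>R einstein g x + ((fR * R0 - f R0) / 2) *\<^sub>R g x \<and>
        fR *\<^sub>R einstein g x + ((fR * R0 - f R0) / 2) *\<^sub>R g x = \<kappa> *\<^sub>R Tm x"
      using red field by metis
    ultimately show ?thesis by (intro conjI[OF _ conjI[OF _ impI[OF dust]]])
  qed
  show ?thesis
    unfolding Let_def
    by (intro exI[of _ R0] conjI[OF R0] allI impI)
      (rule main[OF refl, unfolded g_def fR_def])
qed

end
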